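(* Let $G$ be a finite group of order at least $2$. Then $\alpha(G)=1$ if and only if $G$ is a cyclic group of order at least $3$.
   Context: A subset $D$ of a group $G$ is a determining set of $G$ if the only automorphism of $G$ that fixes every element of $D$ is the identity automorphism. The determining number $\alpha(G)$ is the cardinality of a smallest determining set of $G$; if $G$ has only the identity automorphism then $\alpha(G)=0$. *)

theory Defs
  imports "HOL-Algebra.Algebra"
begin

definition determining_set :: "('a, 'b) monoid_scheme \<Rightarrow> 'a set \<Rightarrow> bool"
  where "determining_set G D \<longleftrightarrow>
    D \<subseteq> carrier G \<and>
    (\<forall>f \<in> auto G. (\<forall>x \<in> D. f x = x) \<longrightarrow> f = \<one>\<^bsub>AutoGroup G\<^esub>)"

(* finite D excludes infinite sets, for which card is 0. For a group without a finite
   determining set (necessarily infinite) the value is meaningless. *)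
definition determining_number :: "('a, 'b) monoid_scheme \<Rightarrow> nat"
  where "determining_number G = (LEAST n. \<exists>D. determining_set G D \<and> finite D \<and> card D = n)"

lemma determining_number_eq_0:
  assumes "auto G = {\<one>\<^bsub>AutoGroup G\<^esub>}"
  shows "determining_number G = 0"
proof -
  have "determining_set G {} \<and> finite {} \<and> card ({} :: 'a set) = 0"
    using assms by (simp add: determining_set_def)
  then show ?thesis
    unfolding determining_number_def by (metis (lifting) Least_eq_0)
qed

end

theory Submission
  imports Defs
begin

text \<open>
  If \<open>G\<close> is cyclic with generator \<open>x\<close>, an automorphism fixing \<open>x\<close> is the identity, while inversion
  moves \<open>x\<close> as soon as \<open>G\<close> has more than two elements; so the determining number is then exactly 1.
  A group of order 2 has only the identity automorphism and determining number 0.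

  Conversely, let \<open>{x}\<close> be a determining set. Conjugation by \<open>x\<close> fixes \<open>x\<close>, so \<open>x\<close> is central;
  hence conjugation by any element fixes \<open>x\<close>, and \<open>G\<close> is abelian. The point \<open>x\<close> need not generate
  \<open>G\<close>: in the cyclic group of order 6 an element of order 3 is determining. This is essentially
  the only obstruction. If \<open>x\<close> lies in a maximal subgroup \<open>H\<close>, then \<open>G = H\<langle>y\<rangle>\<close> for every
  \<open>y\<close> outside \<open>H\<close>, and \<open>h y\<^sup>k \<mapsto> h w\<^sup>k\<close> is an automorphism fixing \<open>H\<close> whenever \<open>w\<close> is also outside
  \<open>H\<close> and the powers of \<open>y\<close> in \<open>H\<close> agree with the corresponding powers of \<open>w\<close>
  (\<open>maximal_subgroup_automorphism\<close>). Since \<open>x\<close> is fixed, no such \<open>w \<noteq> y\<close> can exist. Feeding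
  suitable \<open>w\<close> into this shows that \<open>G\<close> has exactly one involution \<open>z\<close> and that \<open>z \<notin> \<langle>x\<rangle>\<close>
  (\<open>determining_nongenerator_unique_involution\<close>). Every automorphism fixes \<open>z\<close>, so \<open>xz\<close> is
  determining too; but \<open>x\<close> has odd order \<open>m\<close>, so \<open>z = (xz)\<^sup>m\<close> does lie in \<open>\<langle>xz\<rangle>\<close>. By the same
  result applied to \<open>xz\<close>, the element \<open>xz\<close> generates \<open>G\<close>.
\<close>

section \<open>Determining sets\<close>

lemma auto_bij: "f \<in> auto G \<Longrightarrow> bij_betw f (carrier G) (carrier G)"
  by (simp add: auto_def Bij_def)

lemma auto_closed: "f \<in> auto G \<Longrightarrow> g \<in> carrier G \<Longrightarrow> f g \<in> carrier G"
  using auto_bij bij_betwE by blast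

lemma auto_one: "group G \<Longrightarrow> f \<in> auto G \<Longrightarrow> f \<one>\<^bsub>G\<^esub> = \<one>\<^bsub>G\<^esub>"
  by (simp add: auto_def hom_one)

lemma auto_int_pow:
  assumes "group G" "f \<in> auto G" "g \<in> carrier G"
  shows "f (g [^]\<^bsub>G\<^esub> (k::int)) = f g [^]\<^bsub>G\<^esub> k"
  using assms by (intro group_hom.hom_int_pow) (auto simp: auto_def group_hom_def group_hom_axioms_def)

text \<open>Automorphisms are extensional functions, so being the identity of the automorphism group
  only has to be tested on the carrier.\<close>

lemma auto_eq_one_iff:
  assumes "f \<in> auto G"
  shows "f = \<one>\<^bsub>AutoGroup G\<^esub> \<longleftrightarrow> (\<forall>g\<in>carrier G. f g = g)"
proof -
  have "f \<in> extensional (carrier G)"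
    using assms by (simp add: auto_def Bij_def)
  then show ?thesis
    by (auto simp: AutoGroup_def BijGroup_def intro: extensionalityI[of _ "carrier G"])
qed

lemma determining_set_iff:
  "determining_set G D \<longleftrightarrow> D \<subseteq> carrier G \<and>
    (\<forall>f\<in>auto G. (\<forall>x\<in>D. f x = x) \<longrightarrow> (\<forall>g\<in>carrier G. f g = g))"
  unfolding determining_set_def using auto_eq_one_iff[of _ G] by metis

lemma determining_singletonD:
  assumes "determining_set G {x}" "f \<in> auto G" "f x = x" "g \<in> carrier G"
  shows "f g = g"
  using assms by (auto simp: determining_set_iff)

lemma restrict_in_auto:
  assumes "group G" "f \<in> hom G G" "bij_betw f (carrier G) (carrier G)"
  shows "restrict f (carrier G) \<in> auto G"
proof -
  interpret group G by fact
  have "restrict f (carrier G) \<in> hom G G"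
    using assms(2) by (auto simp: hom_def)
  with assms(3) show ?thesis
    by (simp add: auto_def Bij_def)
qed

lemma determining_number_eq_1_iff:
  assumes "finite (carrier G)"
  shows "determining_number G = 1 \<longleftrightarrow> (\<exists>x. determining_set G {x}) \<and> \<not> determining_set G {}"
proof -
  define P where "P n \<longleftrightarrow> (\<exists>D. determining_set G D \<and> finite D \<and> card D = n)" for n
  have num: "determining_number G = (LEAST n. P n)"
    by (simp add: determining_number_def P_def)
  \<comment> \<open>The carrier is a finite determining set, so the minimum is attained.\<close>
  have "determining_set G (carrier G)"
    by (simp add: determining_set_iff)
  with assms have "P (card (carrier G))"
    by (auto simp: P_def)
  then have least: "P (LEAST n. P n)"
    by (rule LeastI)
  have P0: "P 0 \<longleftrightarrow> determining_set G {}"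
    by (auto simp: P_def)
  have P1: "P 1 \<longleftrightarrow> (\<exists>x. determining_set G {x})"
    unfolding P_def by (metis card_1_singletonE card.empty card.insert empty_iff finite.intros One_nat_def)
  show ?thesis
  proof
    assume "determining_number G = 1"
    then show "(\<exists>x. determining_set G {x}) \<and> \<not> determining_set G {}"
      using least P0 P1 not_less_Least[of 0 P] num by auto
  next
    assume R: "(\<exists>x. determining_set G {x}) \<and> \<not> determining_set G {}"
    show "determining_number G = 1"
      unfolding num
    proof (rule Least_equality)
      show "P 1" using R P1 by simp
      show "1 \<le> n" if "P n" for n
        using that R P0 by (cases n) auto
    qed
  qed
qed

section \<open>Cyclic groups\<close>

lemma (in comm_group) inversion_in_auto: "(\<lambda>g\<in>carrier G. inv g) \<in> auto G"
proof (rule restrict_in_auto)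
  show "bij_betw (\<lambda>g. inv g) (carrier G) (carrier G)"
    by (rule bij_betw_byWitness[where f' = "\<lambda>g. inv g"]) auto
  show "(\<lambda>g. inv g) \<in> hom G G"
    by (auto simp: hom_def inv_mult)
qed (rule is_group)

lemma (in group) generator_determining:
  assumes "x \<in> carrier G" "carrier G = range (\<lambda>k::int. x [^] k)"
  shows "determining_set G {x}"
  unfolding determining_set_iff
proof (intro conjI ballI impI)
  fix f g assume f: "f \<in> auto G" "\<forall>y\<in>{x}. f y = y" and "g \<in> carrier G"
  then obtain k :: int where "g = x [^] k"
    using assms(2) by auto
  then show "f g = g"
    using f auto_int_pow[OF is_group f(1) assms(1)] by simp
qed (use assms in auto)

lemma (in group) generator_square_one_imp_order_le_2:
  assumes x: "x \<in> carrier G" and gen: "carrier G = range (\<lambda>k::int. x [^] k)"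
    and sq: "inv x = x"
  shows "order G \<le> 2"
proof -
  have sq1: "x [^] (2::int) = \<one>"
    using x sq int_pow_mult[OF x, of 1 1] r_inv[OF x] by simp
  have "x [^] k \<in> {\<one>, x}" for k :: int
  proof -
    have "x [^] k = x [^] (2 * (k div 2)) \<otimes> x [^] (k mod 2)"
      using int_pow_mult[OF x, of "2 * (k div 2)" "k mod 2"] by simp
    also have "\<dots> = x [^] (k mod 2)"
      using int_pow_pow[OF x, of 2 "k div 2"] sq1 x by simp
    finally show ?thesis
      using x by (cases "even k") (auto simp: even_iff_mod_2_eq_zero odd_iff_mod_2_eq_one)
  qed
  then have "carrier G \<subseteq> {\<one>, x}"
    using gen by auto
  then have "card (carrier G) \<le> card {\<one>, x}"
    by (intro card_mono) auto
  also have "\<dots> \<le> 2"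
    by (simp add: card_insert_if)
  finally show ?thesis
    by (simp add: order_def)
qed

lemma order_2_empty_determining:
  assumes "group G" "order G = 2"
  shows "determining_set G {}"
proof -
  interpret group G by fact
  obtain a where a: "carrier G = {\<one>\<^bsub>G\<^esub>, a}" "a \<noteq> \<one>\<^bsub>G\<^esub>"
  proof -
    have "card (carrier G) = 2"
      using assms(2) by (simp add: order_def)
    then obtain b c where "carrier G = {b, c}" "b \<noteq> c"
      by (auto simp: card_2_iff)
    then show thesis
      using that one_closed by (metis insert_commute insert_iff singletonD)
  qed
  show ?thesis
    unfolding determining_set_iff
  proof (intro conjI ballI impI)
    fix f g assume f: "f \<in> auto G" and g: "g \<in> carrier G"
    have "f a \<noteq> f \<one>\<^bsub>G\<^esub>"
      using auto_bij[OF f] a by (auto simp: bij_betw_def inj_on_def)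
    then have "f a = a"
      using auto_one[OF is_group f] auto_closed[OF f, of a] a by auto
    then show "f g = g"
      using g a auto_one[OF is_group f] by auto
  qed simp
qed

section \<open>A determining point forces commutativity\<close>

lemma (in group) conjugation_in_auto:
  assumes a: "a \<in> carrier G"
  shows "(\<lambda>g\<in>carrier G. a \<otimes> g \<otimes> inv a) \<in> auto G"
proof (rule restrict_in_auto)
  have cancel: "a \<otimes> (inv a \<otimes> g) = g" "inv a \<otimes> (a \<otimes> g) = g" if "g \<in> carrier G" for g
    using a that by (simp_all flip: m_assoc)
  show "bij_betw (\<lambda>g. a \<otimes> g \<otimes> inv a) (carrier G) (carrier G)"
    using a by (intro bij_betw_byWitness[where f' = "\<lambda>g. inv a \<otimes> g \<otimes> a"])
      (auto simp: m_assoc cancel)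
  have "a \<otimes> (g \<otimes> h) \<otimes> inv a = (a \<otimes> g \<otimes> inv a) \<otimes> (a \<otimes> h \<otimes> inv a)"
    if "g \<in> carrier G" "h \<in> carrier G" for g h
    using that a by (simp add: m_assoc cancel)
  then show "(\<lambda>g. a \<otimes> g \<otimes> inv a) \<in> hom G G"
    using a by (auto simp: hom_def)
qed (rule is_group)

lemma (in group) determining_singleton_imp_comm_group:
  assumes det: "determining_set G {x}"
  shows "comm_group G"
proof -
  have x: "x \<in> carrier G"
    using det by (simp add: determining_set_iff)
  \<comment> \<open>Used twice: with \<open>a = x\<close> it makes \<open>x\<close> central, and then it makes every \<open>a\<close> central.\<close>
  have conj: "a \<otimes> g = g \<otimes> a"
    if a: "a \<in> carrier G" and g: "g \<in> carrier G" and ax: "a \<otimes> x = x \<otimes> a" for a g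
  proof -
    have "a \<otimes> x \<otimes> inv a = x"
      using a x ax by (simp add: m_assoc)
    then have "a \<otimes> g \<otimes> inv a = g"
      using determining_singletonD[OF det conjugation_in_auto[OF a] _ g] x g by simp
    then show ?thesis
      using a g by (metis inv_closed inv_solve_right' m_closed)
  qed
  have "a \<otimes> x = x \<otimes> a" if "a \<in> carrier G" for a
    using conj[OF x that] by simp
  then show ?thesis
    using conj by (intro group_comm_groupI) auto
qed

section \<open>Automorphisms fixing a maximal subgroup\<close>

definition maximal_subgroup :: "'a set \<Rightarrow> ('a, 'b) monoid_scheme \<Rightarrow> bool"
  where "maximal_subgroup H G \<longleftrightarrow> subgroup H G \<and> H \<noteq> carrier G \<and>
    (\<forall>K. subgroup K G \<longrightarrow> H \<subseteq> K \<longrightarrow> K = H \<or> K = carrier G)"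

lemma (in group) exists_maximal_subgroup:
  assumes fin: "finite (carrier G)" and K: "subgroup K G" "K \<noteq> carrier G"
  obtains H where "maximal_subgroup H G" "K \<subseteq> H"
proof -
  define S where "S = {L. subgroup L G \<and> L \<noteq> carrier G \<and> K \<subseteq> L}"
  have "S \<subseteq> Pow (carrier G)"
    by (auto simp: S_def dest: subgroup.subset)
  then have "finite S"
    using fin by (meson finite_Pow_iff finite_subset)
  moreover have "K \<in> S"
    using K by (simp add: S_def)
  ultimately obtain H where H: "H \<in> S" "K \<subseteq> H" "\<And>L. L \<in> S \<Longrightarrow> H \<subseteq> L \<Longrightarrow> H = L"
    by (metis finite_has_maximal2)
  then have "maximal_subgroup H G"
    by (auto simp: maximal_subgroup_def S_def)
  with H show thesis
    using that by blast
qed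

lemma (in group) mult_notin_subgroup:
  assumes H: "subgroup H G" and "y \<in> carrier G" "y \<notin> H" "h \<in> H"
  shows "y \<otimes> h \<notin> H"
proof
  assume "y \<otimes> h \<in> H"
  then have "y \<otimes> h \<otimes> inv h \<in> H"
    using H assms(4) by (simp add: subgroup.m_closed subgroup.m_inv_closed)
  then show False
    using assms subgroup.mem_carrier[OF H] by (simp add: m_assoc)
qed

text \<open>The exponents \<open>k\<close> with \<open>y\<^sup>k \<in> H\<close> form an ideal of the integers containing the prime \<open>q\<close>
  but not 1, hence the ideal generated by \<open>q\<close>.\<close>

lemma (in group) prime_power_mem_iff:
  assumes H: "subgroup H G" and y: "y \<in> carrier G" "y \<notin> H" and q: "Factorial_Ring.prime (q::nat)" "y [^] int q \<in> H"
  shows "y [^] (k::int) \<in> H \<longleftrightarrow> int q dvd k"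
proof
  assume k: "y [^] k \<in> H"
  show "int q dvd k"
  proof (rule ccontr)
    assume "\<not> int q dvd k"
    then have "coprime (int q) k"
      using q by (simp add: prime_imp_coprime)
    then obtain a b where "a * int q + b * k = 1"
      by (metis bezout_int coprime_iff_gcd_eq_1)
    then have "y = (y [^] int q) [^] a \<otimes> (y [^] k) [^] b"
      using y int_pow_mult[OF y(1), of "int q * a" "k * b"]
      by (simp only: int_pow_pow) (simp add: mult.commute)
    also have "\<dots> \<in> H"
      using k q H by (simp only: subgroup.m_closed subgroup_int_pow_closed)
    finally show False using y by simp
  qed
next
  assume "int q dvd k"
  then obtain j where "k = int q * j" by blast
  then show "y [^] k \<in> H"
    using y q H by (metis int_pow_pow subgroup_int_pow_closed)
qed

text \<open>Among all elements outside \<open>H\<close>, choose one with a power in \<open>H\<close> of least possible positive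
  exponent: a proper factorisation of the exponent would give a smaller one.\<close>

lemma (in group) exists_prime_power_mem:
  assumes fin: "finite (carrier G)" and H: "subgroup H G" "H \<noteq> carrier G"
  obtains y q where "y \<in> carrier G" "y \<notin> H" "Factorial_Ring.prime (q::nat)" "y [^] int q \<in> H"
proof -
  define P where "P n \<longleftrightarrow> 0 < n \<and> (\<exists>y\<in>carrier G. y \<notin> H \<and> y [^] int n \<in> H)" for n
  obtain v where v: "v \<in> carrier G" "v \<notin> H"
    using H subgroup.subset by blast
  have "P (ord v)"
    using v ord_ge_1[OF fin v(1)] subgroup.one_closed[OF H(1)]
    by (auto simp: P_def int_pow_int intro!: bexI[of _ v])
  define q where "q = (LEAST n. P n)"
  have "P q"
    unfolding q_def using \<open>P (ord v)\<close> by (rule LeastI)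
  have min: "q \<le> n" if "P n" for n
    unfolding q_def using that by (rule Least_le)
  obtain y where y: "y \<in> carrier G" "y \<notin> H" "y [^] int q \<in> H" "0 < q"
    using \<open>P q\<close> unfolding P_def by blast
  have "q \<noteq> 1"
    using y by auto
  moreover have "a = 1 \<or> a = q" if "a dvd q" for a
  proof -
    obtain b where b: "q = a * b" using \<open>a dvd q\<close> ..
    show ?thesis
    proof (cases "y [^] int a \<in> H")
      case True
      then have "P a" using y b by (auto simp: P_def)
      then show ?thesis
        using min that y(4) by (metis dvd_imp_le le_antisym)
    next
      case False
      moreover have "(y [^] int a) [^] int b \<in> H"
        using y b by (simp add: int_pow_pow)
      ultimately have "P b"
        using y b by (auto simp: P_def)
      then have "q \<le> b" by (rule min)
      then show ?thesis using b y(4) by simp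
    qed
  qed
  ultimately have "Factorial_Ring.prime q"
    using y(4) by (simp add: prime_nat_iff)
  then show thesis
    using that y by blast
qed

context comm_group
begin

lemma maximal_subgroup_decompose:
  assumes H: "maximal_subgroup H G" and y: "y \<in> carrier G" "y \<notin> H" and g: "g \<in> carrier G"
  obtains h and k :: int where "h \<in> H" "g = h \<otimes> y [^] k"
proof -
  have sH: "subgroup H G"
    using H by (simp add: maximal_subgroup_def)
  have sY: "subgroup (range (\<lambda>k::int. y [^] k)) G"
    using y by (rule_tac subgroup_of_powers)
  let ?K = "H <#> range (\<lambda>k::int. y [^] k)"
  have K: "subgroup ?K G"
    using mult_subgroups[OF sH sY] .
  have "h \<in> ?K" if "h \<in> H" for h
    unfolding set_mult_def using that subgroup.mem_carrier[OF sH that]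
    by (auto intro!: bexI[of _ h] exI[of _ "0::int"])
  moreover have "y \<in> ?K"
    unfolding set_mult_def using y subgroup.one_closed[OF sH]
    by (auto intro!: bexI[of _ \<one>] exI[of _ "1::int"])
  ultimately have "?K = carrier G"
    using H K y by (auto simp: maximal_subgroup_def)
  with g have "g \<in> ?K" by simp
  then show thesis
    using that by (auto simp: set_mult_def)
qed

text \<open>The map \<open>h y\<^sup>k \<mapsto> h w\<^sup>k\<close>. The compatibility hypothesis is what makes it well defined, and
  \<open>w \<notin> H\<close> makes it surjective, because \<open>H\<close> and \<open>w\<close> then generate the group.\<close>

lemma maximal_subgroup_automorphism:
  assumes fin: "finite (carrier G)" and H: "maximal_subgroup H G"
    and y: "y \<in> carrier G" "y \<notin> H" and w: "w \<in> carrier G" "w \<notin> H"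
    and compat: "\<And>k::int. y [^] k \<in> H \<Longrightarrow> w [^] k = y [^] k"
  obtains f where "f \<in> auto G" "\<And>h. h \<in> H \<Longrightarrow> f h = h" "f y = w"
proof -
  have sH: "subgroup H G"
    using H by (simp add: maximal_subgroup_def)
  note Hc = subgroup.mem_carrier[OF sH]
  have unique: "h \<otimes> w [^] k = h' \<otimes> w [^] l"
    if eq: "h \<otimes> y [^] k = h' \<otimes> y [^] l" and h: "h \<in> H" "h' \<in> H" for h h' and k l :: int
  proof -
    have "y [^] (k - l) = inv h \<otimes> h'"
    proof -
      have "h \<otimes> y [^] (k - l) = h'"
        using eq Hc[OF h(1)] Hc[OF h(2)] y by (simp add: int_pow_diff m_assoc[symmetric] inv_solve_right')
      then show ?thesis
        using Hc[OF h(1)] Hc[OF h(2)] y by (metis int_pow_closed inv_solve_left)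
    qed
    moreover from this have "y [^] (k - l) \<in> H"
      using sH h by (simp add: subgroup.m_closed subgroup.m_inv_closed)
    ultimately have "w [^] (k - l) = inv h \<otimes> h'"
      using compat by simp
    then have "h \<otimes> w [^] (k - l) = h'"
      using Hc[OF h(1)] Hc[OF h(2)] w by (simp add: inv_solve_left)
    then show ?thesis
      using Hc[OF h(1)] Hc[OF h(2)] w by (simp add: int_pow_diff m_assoc[symmetric] inv_solve_right')
  qed
  define f where "f g = (SOME v. \<exists>h\<in>H. \<exists>k::int. g = h \<otimes> y [^] k \<and> v = h \<otimes> w [^] k)" for g
  have f: "f (h \<otimes> y [^] k) = h \<otimes> w [^] k" if "h \<in> H" for h and k :: int
  proof -
    have "v = h \<otimes> w [^] k"
      if "\<exists>h'\<in>H. \<exists>l::int. h \<otimes> y [^] k = h' \<otimes> y [^] l \<and> v = h' \<otimes> w [^] l" for v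
      using that unique[OF _ \<open>h \<in> H\<close>] by metis
    then show ?thesis
      unfolding f_def using that by (intro some_equality) auto
  qed
  have hom: "f \<in> hom G G"
  proof (rule homI)
    fix g assume "g \<in> carrier G"
    then obtain h and k :: int where "h \<in> H" "g = h \<otimes> y [^] k"
      by (rule maximal_subgroup_decompose[OF H y])
    then show "f g \<in> carrier G"
      using f Hc w by simp
  next
    fix g g' assume "g \<in> carrier G" "g' \<in> carrier G"
    then obtain h h' and k k' :: int
      where g: "h \<in> H" "g = h \<otimes> y [^] k" "h' \<in> H" "g' = h' \<otimes> y [^] k'"
      by (metis maximal_subgroup_decompose[OF H y])
    have "g \<otimes> g' = (h \<otimes> h') \<otimes> y [^] (k + k')"
      using g Hc y by (simp add: int_pow_mult m_ac)
    then have "f (g \<otimes> g') = (h \<otimes> h') \<otimes> w [^] (k + k')"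
      using f[of "h \<otimes> h'"] g sH by (simp add: subgroup.m_closed)
    then show "f (g \<otimes> g') = f g \<otimes> f g'"
      using f g Hc w by (simp add: int_pow_mult m_ac)
  qed
  have "carrier G \<subseteq> f ` carrier G"
  proof
    fix g assume "g \<in> carrier G"
    then obtain h and k :: int where hk: "h \<in> H" "g = h \<otimes> w [^] k"
      by (rule maximal_subgroup_decompose[OF H w])
    then have "g = f (h \<otimes> y [^] k)"
      by (simp add: f)
    then show "g \<in> f ` carrier G"
      using hk Hc y by blast
  qed
  moreover have "f ` carrier G \<subseteq> carrier G"
    using hom by (auto simp: hom_def)
  ultimately have bij: "bij_betw f (carrier G) (carrier G)"
    using fin by (simp add: bij_betw_def eq_card_imp_inj_on subset_antisym)
  have fH: "f h = h" if "h \<in> H" for h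
    using f[OF that, of 0] Hc[OF that] by simp
  have fy: "f y = w"
    using f[OF subgroup.one_closed[OF sH], of 1] y w by simp
  show thesis
    using that[OF restrict_in_auto[OF is_group hom bij]] fH fy Hc y by simp
qed

section \<open>Determining points that do not generate\<close>

text \<open>Take a maximal \<open>H\<close> containing \<open>x\<close>, an element \<open>y\<close> outside \<open>H\<close> with \<open>y\<^sup>q \<in> H\<close> for a prime
  \<open>q\<close>, and a power \<open>z\<close> of \<open>y\<close> of order \<open>q\<close>. Were
  \<open>z\<close> in \<open>H\<close>, replacing \<open>y\<close> by \<open>yz\<close> would move \<open>y\<close> while fixing \<open>x\<close>. So \<open>z\<close> complements \<open>H\<close>,
  and replacing \<open>z\<close> by its inverse forces \<open>z\<^sup>2 = 1\<close>. An involution \<open>u\<close> in \<open>H\<close> is excluded by replacing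
  \<open>z\<close> by \<open>zu\<close>; hence \<open>z\<close> is the only involution.\<close>

lemma determining_nongenerator_unique_involution:
  assumes fin: "finite (carrier G)" and det: "determining_set G {x}"
    and ngen: "range (\<lambda>k::int. x [^] k) \<noteq> carrier G"
  shows "\<exists>z\<in>carrier G. z \<noteq> \<one> \<and> z \<otimes> z = \<one> \<and> z \<notin> range (\<lambda>k::int. x [^] k) \<and>
    (\<forall>u\<in>carrier G. u \<noteq> \<one> \<longrightarrow> u \<otimes> u = \<one> \<longrightarrow> u = z)"
proof -
  have x: "x \<in> carrier G"
    using det by (simp add: determining_set_iff)
  obtain H where H: "maximal_subgroup H G" and xH: "range (\<lambda>k::int. x [^] k) \<subseteq> H"
    using exists_maximal_subgroup[OF fin subgroup_of_powers[OF x] ngen] .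
  have sH: "subgroup H G" and HG: "H \<noteq> carrier G"
    using H by (simp_all add: maximal_subgroup_def)
  note Hc = subgroup.mem_carrier[OF sH]
  have "x [^] (1::int) \<in> H"
    using xH by blast
  then have "x \<in> H"
    using x by simp
  \<comment> \<open>An automorphism taking \<open>y\<close> to \<open>w\<close> and fixing \<open>H\<close> fixes \<open>x\<close>, so it is the identity.\<close>
  have rigid: "w = y"
    if "y \<in> carrier G" "y \<notin> H" "w \<in> carrier G" "w \<notin> H"
      "\<And>k::int. y [^] k \<in> H \<Longrightarrow> w [^] k = y [^] k" for y w
    using maximal_subgroup_automorphism[OF fin H that] determining_singletonD[OF det] \<open>x \<in> H\<close> that(1)
    by metis
  obtain y q where y: "y \<in> carrier G" "y \<notin> H" and q: "Factorial_Ring.prime (q::nat)" "y [^] int q \<in> H"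
    using exists_prime_power_mem[OF fin sH HG] .
  have "y [^] int (ord y) \<in> H"
    using y sH by (simp add: int_pow_int subgroup.one_closed)
  then have "q dvd ord y"
    using prime_power_mem_iff[OF sH y q] by simp
  then obtain m where m: "ord y = q * m" by blast
  have "0 < ord y"
    using ord_ge_1[OF fin y(1)] by simp
  define z where "z = y [^] m"
  have z: "z \<in> carrier G"
    using y by (simp add: z_def)
  have zq: "z [^] int q = \<one>"
    using pow_ord_eq_1[OF y(1)] y m by (simp only: z_def int_pow_int nat_pow_pow mult.commute)
  have z1: "z \<noteq> \<one>"
  proof
    assume "z = \<one>"
    then have "q * m dvd m"
      using pow_eq_id[OF y(1)] m by (simp add: z_def)
    then have "q * m \<le> m"
      using m \<open>0 < ord y\<close> by (auto dest: dvd_imp_le)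
    then show False
      using m \<open>0 < ord y\<close> prime_gt_1_nat[OF q(1)] by simp
  qed
  have zk: "z [^] k = \<one>" if "int q dvd k" for k :: int
    using that zq z by (metis dvdE int_pow_pow int_pow_one)
  have zH: "z \<notin> H"
  proof
    assume "z \<in> H"
    have "y \<otimes> z \<notin> H"
      using mult_notin_subgroup[OF sH y \<open>z \<in> H\<close>] .
    then have "y \<otimes> z = y"
      using y z zk prime_power_mem_iff[OF sH y q] by (rule_tac rigid) (auto simp: int_pow_distrib)
    then show False using y z z1 by simp
  qed
  have zqH: "z [^] int q \<in> H"
    using zq sH by (simp add: subgroup.one_closed)
  note zkH = prime_power_mem_iff[OF sH z zH q(1) zqH]
  have "inv z = z"
  proof (rule rigid)
    show "inv z \<notin> H"
      using zH z sH by (metis inv_inv subgroup.m_inv_closed)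
    show "inv z [^] k = z [^] k" if "z [^] k \<in> H" for k :: int
      using that zkH zk z by (simp add: int_pow_inv)
  qed (use z zH in auto)
  then have zz: "z \<otimes> z = \<one>"
    using z by (metis r_inv)
  then have "z [^] (2::int) \<in> H"
    using int_pow_mult[OF z, of 1 1] z sH by (simp add: subgroup.one_closed)
  then have "int q dvd 2"
    using zkH by blast
  then have "q dvd 2"
    by (metis int_dvd_int_iff of_nat_numeral)
  then have q2: "q = 2"
    using q(1) by (simp add: primes_dvd_imp_eq two_is_prime_nat)
  have noinv: "u = \<one>" if u: "u \<in> H" "u \<otimes> u = \<one>" for u
  proof -
    have uG: "u \<in> carrier G" using Hc u by simp
    have "z \<otimes> u \<notin> H"
      using mult_notin_subgroup[OF sH z zH u(1)] .
    moreover have "(z \<otimes> u) [^] k = z [^] k" if "z [^] k \<in> H" for k :: int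
    proof -
      have "2 dvd k"
        using that zkH[of k] q2 by simp
      then obtain j where "k = 2 * j" ..
      moreover have "u [^] (2::int) = \<one>"
        using int_pow_mult[OF uG, of 1 1] uG u by simp
      ultimately have "u [^] k = \<one>"
        using int_pow_pow[OF uG, of 2 j] by simp
      then show ?thesis
        using z uG by (simp add: int_pow_distrib)
    qed
    ultimately have "z \<otimes> u = z"
      using z zH uG by (rule_tac rigid) auto
    then show ?thesis using z uG by simp
  qed
  \<comment> \<open>Writing \<open>u = h z\<^sup>k\<close>, the square of \<open>u\<close> is that of \<open>h\<close>, so \<open>h = 1\<close>.\<close>
  have uniq: "u = z" if u: "u \<in> carrier G" "u \<noteq> \<one>" "u \<otimes> u = \<one>" for u
  proof -
    obtain h and k :: int where hk: "h \<in> H" "u = h \<otimes> z [^] k"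
      by (rule maximal_subgroup_decompose[OF H z zH u(1)])
    have hG: "h \<in> carrier G" using Hc hk by simp
    have sq: "z [^] (2 * j) = \<one>" for j :: int
      using zk q2 by simp
    have "u \<otimes> u = (h \<otimes> h) \<otimes> z [^] (2 * k)"
      using hk hG z int_pow_mult[OF z, of k k] by (simp add: m_ac)
    then have "h \<otimes> h = \<one>"
      using u sq hG by simp
    then have "h = \<one>"
      using noinv hk by simp
    then have uk: "u = z [^] k"
      using hk z by simp
    then have "odd k"
      using u sq by auto
    then obtain j where "k = 2 * j + 1"
      using oddE by blast
    then show ?thesis
      using uk sq z by (simp add: int_pow_mult)
  qed
  have "z \<notin> range (\<lambda>k::int. x [^] k)"
    using xH zH by blast
  with z z1 zz uniq show ?thesis
    by blast
qed

text \<open>If \<open>x\<close> is not itself a generator, then \<open>xz\<close> is one, where \<open>z\<close> is the unique involution: being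
  unique, \<open>z\<close> is fixed by every automorphism, so \<open>xz\<close> is as rigid as \<open>x\<close>; but the powers of \<open>xz\<close>
  include \<open>z\<close>, which rules out the alternative in
  \<open>determining_nongenerator_unique_involution\<close>.\<close>

lemma determining_singleton_imp_generated_by_one:
  assumes fin: "finite (carrier G)" and det: "determining_set G {x}"
  shows "\<exists>g\<in>carrier G. carrier G = range (\<lambda>k::int. g [^] k)"
proof (cases "range (\<lambda>k::int. x [^] k) = carrier G")
  case True
  then show ?thesis
    using det by (auto simp: determining_set_iff)
next
  case False
  have x: "x \<in> carrier G"
    using det by (simp add: determining_set_iff)
  obtain z where z: "z \<in> carrier G" "z \<noteq> \<one>" "z \<otimes> z = \<one>"
    and zx: "z \<notin> range (\<lambda>k::int. x [^] k)"
    and uniq: "\<And>u. u \<in> carrier G \<Longrightarrow> u \<noteq> \<one> \<Longrightarrow> u \<otimes> u = \<one> \<Longrightarrow> u = z"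
    using determining_nongenerator_unique_involution[OF fin det False] by blast
  \<comment> \<open>Otherwise the unique involution would be a power of \<open>x\<close>.\<close>
  have "odd (ord x)"
  proof
    assume "even (ord x)"
    then obtain m where m: "ord x = 2 * m" by blast
    have pos: "0 < ord x"
      using ord_ge_1[OF fin x] by simp
    have "x [^] m \<noteq> \<one>"
      using pow_eq_id[OF x, of m] m pos by (auto dest: dvd_imp_le)
    moreover have "x [^] m \<otimes> x [^] m = \<one>"
      using pow_ord_eq_1[OF x] x m by (simp only: nat_pow_mult mult_2)
    ultimately have "x [^] int m = z"
      using uniq[of "x [^] m"] x by (simp add: int_pow_int)
    then show False using zx by blast
  qed
  then obtain j where j: "ord x = 2 * j + 1"
    using oddE by blast
  have "z [^] (2::nat) = \<one>"
    using z by (simp add: numeral_2_eq_2)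
  then have "z [^] ord x = z"
    using z j nat_pow_pow[of z 2 j] nat_pow_mult[of z "2 * j" 1] by simp
  then have "(x \<otimes> z) [^] ord x = z"
    using x z by (simp add: nat_pow_distrib)
  then have mem: "z \<in> range (\<lambda>k::int. (x \<otimes> z) [^] k)"
    by (metis int_pow_int rangeI)
  have "determining_set G {x \<otimes> z}"
    unfolding determining_set_iff
  proof (intro conjI ballI impI)
    fix f g assume f: "f \<in> auto G" and fx: "\<forall>v\<in>{x \<otimes> z}. f v = v" and g: "g \<in> carrier G"
    have hom: "f (a \<otimes> b) = f a \<otimes> f b" if "a \<in> carrier G" "b \<in> carrier G" for a b
      using f that by (simp add: auto_def hom_def)
    have "f z \<noteq> f \<one>"
      using auto_bij[OF f] z by (auto simp: bij_betw_def inj_on_def)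
    then have "f z \<noteq> \<one>"
      using auto_one[OF is_group f] by simp
    moreover have "f z \<otimes> f z = \<one>"
      using hom[OF z(1) z(1)] z(3) auto_one[OF is_group f] by simp
    ultimately have "f z = z"
      using uniq auto_closed[OF f z(1)] by blast
    then have "f x = x"
      using fx hom[of x z] x z auto_closed[OF f x] by simp
    then show "f g = g"
      using determining_singletonD[OF det f _ g] by simp
  qed (use x z in simp)
  then have "range (\<lambda>k::int. (x \<otimes> z) [^] k) = carrier G"
    using determining_nongenerator_unique_involution[OF fin, of "x \<otimes> z"] mem uniq z by metis
  then show ?thesis
    using x z by (metis m_closed)
qed

end

section \<open>Groups of determining number one\<close>

theorem theorem4p3:
  fixes G :: "('a, 'b) monoid_scheme"
  assumes "group G" and "finite (carrier G)" and "order G \<ge> 2"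
  shows "determining_number G = 1 \<longleftrightarrow> cyclic_group G \<and> order G \<ge> 3"
proof -
  interpret group G by fact
  show ?thesis
  proof
    assume "determining_number G = 1"
    then obtain x where det: "determining_set G {x}" and ne: "\<not> determining_set G {}"
      using determining_number_eq_1_iff[OF assms(2)] by blast
    interpret comm_group G
      using determining_singleton_imp_comm_group[OF det] .
    have "cyclic_group G"
      using determining_singleton_imp_generated_by_one[OF assms(2) det] cyclic_group by simp
    moreover have "order G \<noteq> 2"
      using order_2_empty_determining[OF assms(1)] ne by blast
    ultimately show "cyclic_group G \<and> order G \<ge> 3"
      using assms(3) by simp
  next
    assume R: "cyclic_group G \<and> order G \<ge> 3"
    then obtain x where x: "x \<in> carrier G" "carrier G = range (\<lambda>k::int. x [^]\<^bsub>G\<^esub> k)"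
      using cyclic_group by blast
    interpret comm_group G
      using cyclic_imp_abelian_group R by blast
    have "inv\<^bsub>G\<^esub> x \<noteq> x"
      using generator_square_one_imp_order_le_2[OF x] R by auto
    then have "\<not> determining_set G {}"
      unfolding determining_set_iff using inversion_in_auto x(1) by
      (auto intro!: bexI[of _ x] bexI[OF _ inversion_in_auto])
    then show "determining_number G = 1"
      using determining_number_eq_1_iff[OF assms(2)] generator_determining[OF x] by blast
  qed
qed

end
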